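(* Let $G$ be a graph and let $\mathcal{W}$ be a set of closed walks in $G$. Then there exists a signature $\sigma$ of $G$ such that $\mathcal{W}$ is exactly the set of negative closed walks in the signed graph $(G,\sigma)$ if and only if $\mathcal{W}$ satisfies the exclusive 3-walk property.
   Context: Graphs may have loops and multiple edges: the vertex and edge sets are disjoint, and each edge has a multiset of two endpoints. A walk is a sequence $W=v_0e_1v_1e_2\cdots e_kv_k$ where the endpoints of $e_i$ are $v_{i-1}$ and $v_i$; it is a $v_0v_k$-walk of length $k$. It is closed if $v_k=v_0$; a trivial walk (length $0$, one vertex, no edge) is a closed walk. The inverse is $W^{-1}=v_ke_k\cdots e_1v_0$, and $W_1W_2$ denotes concatenation when $W_2$ starts where $W_1$ ends. A signature of $G$ is a map $\sigma:E(G)\to\{+,-\}$; the pair $(G,\sigma)$ is a signed graph. The sign of a walk is the product of the signs of its edges, counted with repetition (the empty product is $+$); a closed walk is negative if its sign is $-$. A set $\mathcal{W}$ of closed walks has the rotation property if for each closed walk that is a concatenation $PQ$ of walks $P$ and $Q$ (with $P$ an $xy$-walk and $Q$ a $yx$-walk), either both $PQ$ and $QP$ are in $\mathcal{W}$ or neither is. A set $\mathcal{W}$ of closed walks satisfies the exclusive 3-walk property if it has the rotation property and, for every two vertices $x,y$ (not necessarily distinct) and every three $xy$-walks $W_1,W_2,W_3$ (not necessarily distinct), an even number (zero or two, counted by pairs of indices) of the three closed walks $W_1W_2^{-1}$, $W_1W_3^{-1}$, $W_2W_3^{-1}$ belong to $\mathcal{W}$. Equivalently, with $\sigma_{\mathcal{W}}(W)=-$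 if $W\in\mathcal{W}$ and $\sigma_{\mathcal{W}}(W)=+$ if $W\notin\mathcal{W}$, one has $\sigma_{\mathcal{W}}(W_1W_2^{-1})\,\sigma_{\mathcal{W}}(W_1W_3^{-1})\,\sigma_{\mathcal{W}}(W_2W_3^{-1})=+$. *)

theory Defs
  imports Main "HOL-Library.Multiset" "HOL-Library.FuncSet"
begin

text \<open>Undirected graphs with loops and multiple edges. Vertices and edges live in different
  types, so the vertex set and the edge set are disjoint by construction. A loop at \<open>v\<close> has
  endpoints \<open>{#v, v#}\<close>.\<close>

record ('v, 'e) multigraph =
  verts :: "'v set"
  edges :: "'e set"
  ends :: "'e \<Rightarrow> 'v multiset"

definition graph :: "('v, 'e) multigraph \<Rightarrow> bool" where
  "graph G \<longleftrightarrow> (\<forall>e\<in>edges G. size (ends G e) = 2 \<and> set_mset (ends G e) \<subseteq> verts G)"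

text \<open>The sequence \<open>v\<^sub>0 e\<^sub>1 v\<^sub>1 \<dots> e\<^sub>k v\<^sub>k\<close> is
  \<open>Step v\<^sub>0 e\<^sub>1 (Step v\<^sub>1 e\<^sub>2 (\<dots> (Trivial v\<^sub>k)))\<close>.\<close>

datatype ('v, 'e) walk = Trivial 'v | Step 'v 'e "('v, 'e) walk"

primrec walk_start :: "('v, 'e) walk \<Rightarrow> 'v" where
  "walk_start (Trivial v) = v"
| "walk_start (Step v e W) = v"

primrec walk_end :: "('v, 'e) walk \<Rightarrow> 'v" where
  "walk_end (Trivial v) = v"
| "walk_end (Step v e W) = walk_end W"

primrec walk_edges :: "('v, 'e) walk \<Rightarrow> 'e list" where
  "walk_edges (Trivial v) = []"
| "walk_edges (Step v e W) = e # walk_edges W"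

primrec is_walk :: "('v, 'e) multigraph \<Rightarrow> ('v, 'e) walk \<Rightarrow> bool" where
  "is_walk G (Trivial v) \<longleftrightarrow> v \<in> verts G"
| "is_walk G (Step v e W) \<longleftrightarrow>
     v \<in> verts G \<and> e \<in> edges G \<and> ends G e = {#v, walk_start W#} \<and> is_walk G W"

definition walks_between :: "('v, 'e) multigraph \<Rightarrow> 'v \<Rightarrow> 'v \<Rightarrow> ('v, 'e) walk set" where
  "walks_between G x y = {W. is_walk G W \<and> walk_start W = x \<and> walk_end W = y}"

definition closed_walks :: "('v, 'e) multigraph \<Rightarrow> ('v, 'e) walk set" where
  "closed_walks G = {W. is_walk G W \<and> walk_start W = walk_end W}"

text \<open>Concatenation is meaningful only if the second walk starts where the first one ends; the
  last vertex of the first walk is then identified with the first vertex of the second.\<close>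

primrec walk_concat :: "('v, 'e) walk \<Rightarrow> ('v, 'e) walk \<Rightarrow> ('v, 'e) walk" (infixr "\<cdot>" 70) where
  "Trivial v \<cdot> W' = W'"
| "Step v e W \<cdot> W' = Step v e (W \<cdot> W')"

primrec walk_inverse :: "('v, 'e) walk \<Rightarrow> ('v, 'e) walk" where
  "walk_inverse (Trivial v) = Trivial v"
| "walk_inverse (Step v e W) = walk_inverse W \<cdot> Step (walk_start W) e (Trivial v)"

text \<open>The signs \<open>+\<close> and \<open>-\<close> are the integers \<open>1\<close> and \<open>- 1\<close>.\<close>

definition signature :: "('v, 'e) multigraph \<Rightarrow> ('e \<Rightarrow> int) \<Rightarrow> bool" where
  "signature G \<sigma> \<longleftrightarrow> \<sigma> \<in> edges G \<rightarrow> {1, - 1}"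

definition walk_sign :: "('e \<Rightarrow> int) \<Rightarrow> ('v, 'e) walk \<Rightarrow> int" where
  "walk_sign \<sigma> W = prod_list (map \<sigma> (walk_edges W))"

definition negative_closed_walks ::
    "('v, 'e) multigraph \<Rightarrow> ('e \<Rightarrow> int) \<Rightarrow> ('v, 'e) walk set" where
  "negative_closed_walks G \<sigma> = {W \<in> closed_walks G. walk_sign \<sigma> W = - 1}"

definition rotation_property :: "('v, 'e) multigraph \<Rightarrow> ('v, 'e) walk set \<Rightarrow> bool" where
  "rotation_property G \<W> \<longleftrightarrow>
     (\<forall>x y. \<forall>P\<in>walks_between G x y. \<forall>Q\<in>walks_between G y x. P \<cdot> Q \<in> \<W> \<longleftrightarrow> Q \<cdot> P \<in> \<W>)"

definition exclusive_3_walk_property ::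
    "('v, 'e) multigraph \<Rightarrow> ('v, 'e) walk set \<Rightarrow> bool" where
  "exclusive_3_walk_property G \<W> \<longleftrightarrow>
     rotation_property G \<W> \<and>
     (\<forall>x\<in>verts G. \<forall>y\<in>verts G.
        \<forall>W\<^sub>1\<in>walks_between G x y. \<forall>W\<^sub>2\<in>walks_between G x y. \<forall>W\<^sub>3\<in>walks_between G x y.
          even (of_bool (W\<^sub>1 \<cdot> walk_inverse W\<^sub>2 \<in> \<W>) +
                of_bool (W\<^sub>1 \<cdot> walk_inverse W\<^sub>3 \<in> \<W>) +
                of_bool (W\<^sub>2 \<cdot> walk_inverse W\<^sub>3 \<in> \<W>) :: nat))"

end

theory Submission
  imports Defs
begin

text \<open>
  Negative closed walks form such a set because the sign of a walk is multiplicative under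
  concatenation and invariant under inversion: the three closed walks
  \<open>W\<^sub>1 W\<^sub>2\<^sup>-\<^sup>1\<close>, \<open>W\<^sub>1 W\<^sub>3\<^sup>-\<^sup>1\<close>,
  \<open>W\<^sub>2 W\<^sub>3\<^sup>-\<^sup>1\<close> use the edges of each \<open>W\<^sub>i\<close> twice, so that the
  product of their signs is a square.

  For the converse, give the members of \<open>\<W>\<close> the sign \<open>- 1\<close> and all other walks the sign
  \<open>1\<close>. Taking trivial or repeated walks in the 3-walk property shows that this sign is a
  homomorphism on the closed walks at a fixed vertex and that it is invariant under inversion;
  with rotations, it is also unchanged when a detour \<open>C C\<^sup>-\<^sup>1\<close> is inserted at any place
  of a closed walk (\<open>closed_sign_detour\<close>). Now fix a root in every connected component and a
  walk \<open>P\<^sub>v\<close> from the root to each vertex \<open>v\<close>. Completing an \<open>xy\<close>-walk \<open>W\<close>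
  to the closed walk \<open>P\<^sub>x W P\<^sub>y\<^sup>-\<^sup>1\<close> extends the sign to all walks, and the
  insertion of detours makes this extension multiplicative (\<open>rooted_sign_concat\<close>). Hence the
  extended sign of a walk is the product of the extended signs of its edges, which are the desired
  signature, while on closed walks the extension agrees with the given sign by rotation.
\<close>

section \<open>Concatenation and inversion of walks\<close>

lemma walk_concat_assoc: "(A \<cdot> B) \<cdot> C = A \<cdot> (B \<cdot> C)"
  by (induction A) auto

lemma walk_start_concat:
  "walk_end A = walk_start B \<Longrightarrow> walk_start (A \<cdot> B) = walk_start A"
  by (cases A) auto

lemma walk_end_concat [simp]: "walk_end (A \<cdot> B) = walk_end B"
  by (induction A) auto

lemma walk_concat_Trivial [simp]: "walk_end A = v \<Longrightarrow> A \<cdot> Trivial v = A"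
  by (induction A) auto

lemma is_walk_concat:
  "\<lbrakk>walk_end A = walk_start B; is_walk G A; is_walk G B\<rbrakk> \<Longrightarrow> is_walk G (A \<cdot> B)"
  by (induction A) (auto simp: walk_start_concat)

lemma walk_start_in_verts: "is_walk G A \<Longrightarrow> walk_start A \<in> verts G"
  by (cases A) auto

lemma walk_end_in_verts: "is_walk G A \<Longrightarrow> walk_end A \<in> verts G"
  by (induction A) auto

lemma walk_end_inverse [simp]: "walk_end (walk_inverse A) = walk_start A"
  by (cases A) auto

lemma walk_start_inverse [simp]: "walk_start (walk_inverse A) = walk_end A"
  by (induction A) (auto simp: walk_start_concat)

lemma walk_inverse_concat:
  "walk_end A = walk_start B \<Longrightarrow> walk_inverse (A \<cdot> B) = walk_inverse B \<cdot> walk_inverse A"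
  by (induction A) (auto simp: walk_start_concat walk_concat_assoc)

lemma walk_inverse_inverse [simp]: "walk_inverse (walk_inverse A) = A"
  by (induction A) (auto simp: walk_inverse_concat)

lemma is_walk_inverse: "is_walk G A \<Longrightarrow> is_walk G (walk_inverse A)"
  by (induction A) (auto intro!: is_walk_concat simp: walk_start_in_verts add_mset_commute)

lemma walks_between_concat:
  "\<lbrakk>A \<in> walks_between G x y; B \<in> walks_between G y z\<rbrakk> \<Longrightarrow> A \<cdot> B \<in> walks_between G x z"
  by (auto simp: walks_between_def walk_start_concat intro: is_walk_concat)

lemma walks_between_inverse:
  "A \<in> walks_between G x y \<Longrightarrow> walk_inverse A \<in> walks_between G y x"
  by (auto simp: walks_between_def intro: is_walk_inverse)

lemma walks_between_Trivial: "x \<in> verts G \<Longrightarrow> Trivial x \<in> walks_between G x x"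
  by (simp add: walks_between_def)

lemma walks_between_verts:
  "A \<in> walks_between G x y \<Longrightarrow> x \<in> verts G" "A \<in> walks_between G x y \<Longrightarrow> y \<in> verts G"
  by (auto simp: walks_between_def walk_start_in_verts walk_end_in_verts)

lemma walks_between_closed: "A \<in> walks_between G x x \<Longrightarrow> A \<in> closed_walks G"
  by (auto simp: walks_between_def closed_walks_def)

section \<open>Signs of walks in a signed graph\<close>

lemma walk_sign_Trivial [simp]: "walk_sign \<sigma> (Trivial v) = 1"
  by (simp add: walk_sign_def)

lemma walk_sign_Step [simp]: "walk_sign \<sigma> (Step v e W) = \<sigma> e * walk_sign \<sigma> W"
  by (simp add: walk_sign_def)

lemma walk_sign_concat [simp]: "walk_sign \<sigma> (A \<cdot> B) = walk_sign \<sigma> A * walk_sign \<sigma> B"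
  by (induction A) auto

lemma walk_sign_inverse [simp]: "walk_sign \<sigma> (walk_inverse A) = walk_sign \<sigma> A"
  by (induction A) auto

lemma walk_sign_cases:
  assumes "signature G \<sigma>" "is_walk G A"
  shows "walk_sign \<sigma> A = 1 \<or> walk_sign \<sigma> A = - 1"
  using assms(2)
proof (induction A)
  case (Step v e A)
  then have "\<sigma> e = 1 \<or> \<sigma> e = - 1"
    using assms(1) by (auto simp: signature_def)
  then show ?case
    using Step by auto
qed simp

lemma negative_closed_walks_exclusive:
  assumes "signature G \<sigma>"
  shows "exclusive_3_walk_property G (negative_closed_walks G \<sigma>)"
  unfolding exclusive_3_walk_property_def rotation_property_def
proof (intro conjI ballI allI)
  fix x y P Q
  assume "P \<in> walks_between G x y" "Q \<in> walks_between G y x"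
  then have "P \<cdot> Q \<in> closed_walks G" "Q \<cdot> P \<in> closed_walks G"
    by (auto intro: walks_between_closed walks_between_concat)
  then show "P \<cdot> Q \<in> negative_closed_walks G \<sigma> \<longleftrightarrow> Q \<cdot> P \<in> negative_closed_walks G \<sigma>"
    by (simp add: negative_closed_walks_def mult.commute)
next
  fix x y A B C
  assume walks: "A \<in> walks_between G x y" "B \<in> walks_between G x y" "C \<in> walks_between G x y"
  have mem: "P \<cdot> walk_inverse Q \<in> negative_closed_walks G \<sigma> \<longleftrightarrow>
      walk_sign \<sigma> P * walk_sign \<sigma> Q = - 1"
    if "P \<in> walks_between G x y" "Q \<in> walks_between G x y" for P Q
    using walks_between_closed[OF walks_between_concat[OF that(1) walks_between_inverse[OF that(2)]]]
    by (simp add: negative_closed_walks_def)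
  have signs: "walk_sign \<sigma> P = 1 \<or> walk_sign \<sigma> P = - 1" if "P \<in> walks_between G x y" for P
    using that walk_sign_cases[OF assms] by (simp add: walks_between_def)
  show "even (of_bool (A \<cdot> walk_inverse B \<in> negative_closed_walks G \<sigma>) +
      of_bool (A \<cdot> walk_inverse C \<in> negative_closed_walks G \<sigma>) +
      of_bool (B \<cdot> walk_inverse C \<in> negative_closed_walks G \<sigma>) :: nat)"
    using walks[THEN signs] walks by (auto simp: mem)
qed

section \<open>The sign defined by a set with the exclusive 3-walk property\<close>

locale exclusive_3_walk_set =
  fixes G :: "('v, 'e) multigraph" and \<W> :: "('v, 'e) walk set"
  assumes exclusive: "exclusive_3_walk_property G \<W>"
begin

definition closed_sign :: "('v, 'e) walk \<Rightarrow> int" where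
  "closed_sign W = (if W \<in> \<W> then - 1 else 1)"

lemma closed_sign_cases: "closed_sign W = 1 \<or> closed_sign W = - 1"
  by (simp add: closed_sign_def)

lemma closed_sign_square [simp]: "closed_sign W * closed_sign W = 1"
  by (simp add: closed_sign_def)

lemma closed_sign_rotate:
  "\<lbrakk>P \<in> walks_between G x y; Q \<in> walks_between G y x\<rbrakk>
    \<Longrightarrow> closed_sign (P \<cdot> Q) = closed_sign (Q \<cdot> P)"
  using exclusive
  by (auto simp: exclusive_3_walk_property_def rotation_property_def closed_sign_def)

lemma closed_sign_3_walks:
  assumes "A \<in> walks_between G x y" "B \<in> walks_between G x y" "C \<in> walks_between G x y"
  shows "closed_sign (A \<cdot> walk_inverse B) * closed_sign (A \<cdot> walk_inverse C) *
    closed_sign (B \<cdot> walk_inverse C) = 1"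
proof -
  have "even (of_bool (A \<cdot> walk_inverse B \<in> \<W>) + of_bool (A \<cdot> walk_inverse C \<in> \<W>) +
      of_bool (B \<cdot> walk_inverse C \<in> \<W>) :: nat)"
    using exclusive assms walks_between_verts[OF assms(1)]
    unfolding exclusive_3_walk_property_def by blast
  then show ?thesis
    by (auto simp: closed_sign_def split: if_splits)
qed

text \<open>With three equal walks the 3-walk property says that the cube of this sign is \<open>1\<close>.\<close>

lemma closed_sign_backtrack:
  "A \<in> walks_between G x y \<Longrightarrow> closed_sign (A \<cdot> walk_inverse A) = 1"
  using closed_sign_3_walks[of A x y A A] by simp

lemma closed_sign_inverse:
  assumes A: "A \<in> walks_between G x x"
  shows "closed_sign (walk_inverse A) = closed_sign A"
proof -
  have "A \<cdot> Trivial x = A"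
    using A by (simp add: walks_between_def)
  then have "closed_sign A * closed_sign (walk_inverse A) = 1"
    using closed_sign_3_walks[OF A walks_between_Trivial A] closed_sign_backtrack[OF A]
      walks_between_verts(1)[OF A] by simp
  then show ?thesis
    using closed_sign_cases[of A] by auto
qed

text \<open>Apply the 3-walk property to \<open>A\<close>, the trivial walk and \<open>B\<^sup>-\<^sup>1\<close>.\<close>

lemma closed_sign_concat:
  assumes A: "A \<in> walks_between G x x" and B: "B \<in> walks_between G x x"
  shows "closed_sign (A \<cdot> B) = closed_sign A * closed_sign B"
proof -
  have "A \<cdot> Trivial x = A"
    using A by (simp add: walks_between_def)
  then have "closed_sign A * closed_sign (A \<cdot> B) * closed_sign B = 1"
    using closed_sign_3_walks[OF A walks_between_Trivial walks_between_inverse[OF B]]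
      walks_between_verts(1)[OF A] by simp
  then show ?thesis
    using closed_sign_cases[of A] closed_sign_cases[of B] by auto
qed

text \<open>A rotation brings the detour to the end, where it is a closed factor of sign \<open>1\<close>.\<close>

lemma closed_sign_detour:
  assumes A: "A \<in> walks_between G x y" and B: "B \<in> walks_between G y x"
    and C: "C \<in> walks_between G y z"
  shows "closed_sign (A \<cdot> C \<cdot> walk_inverse C \<cdot> B) = closed_sign (A \<cdot> B)"
proof -
  have detour: "C \<cdot> walk_inverse C \<in> walks_between G y y"
    using C by (blast intro: walks_between_concat walks_between_inverse)
  have "closed_sign (A \<cdot> C \<cdot> walk_inverse C \<cdot> B) = closed_sign ((A \<cdot> C \<cdot> walk_inverse C) \<cdot> B)"
    by (simp add: walk_concat_assoc)
  also have "\<dots> = closed_sign (B \<cdot> A \<cdot> C \<cdot> walk_inverse C)"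
    using closed_sign_rotate[OF walks_between_concat[OF A detour] B] .
  also have "\<dots> = closed_sign ((B \<cdot> A) \<cdot> C \<cdot> walk_inverse C)"
    by (simp add: walk_concat_assoc)
  also have "\<dots> = closed_sign (B \<cdot> A)"
    using closed_sign_concat[OF walks_between_concat[OF B A] detour]
      closed_sign_backtrack[OF C] by simp
  also have "\<dots> = closed_sign (A \<cdot> B)"
    using closed_sign_rotate[OF B A] .
  finally show ?thesis .
qed

section \<open>Extension to all walks through rooted components\<close>

text \<open>The root depends only on the set of vertices that can reach \<open>v\<close>, so that it is the same
  for all vertices of a component.\<close>

definition root :: "'v \<Rightarrow> 'v" where
  "root v = (SOME r. walks_between G r v \<noteq> {})"

definition root_walk :: "'v \<Rightarrow> ('v, 'e) walk" where
  "root_walk v = (SOME P. P \<in> walks_between G (root v) v)"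

definition rooted_sign :: "('v, 'e) walk \<Rightarrow> int" where
  "rooted_sign W =
     closed_sign (root_walk (walk_start W) \<cdot> W \<cdot> walk_inverse (root_walk (walk_end W)))"

text \<open>One orientation of an edge is as good as the other by \<open>rooted_sign_inverse\<close>; the
  existential quantifier avoids the choice of one.\<close>

definition edge_sign :: "'e \<Rightarrow> int" where
  "edge_sign e =
     (if \<exists>u v. Step u e (Trivial v) \<in> walks_between G u v \<and> rooted_sign (Step u e (Trivial v)) = - 1
      then - 1 else 1)"

lemma root_walk:
  assumes "v \<in> verts G"
  shows "root_walk v \<in> walks_between G (root v) v"
proof -
  have "walks_between G v v \<noteq> {}"
    using walks_between_Trivial[OF assms] by blast
  then have "walks_between G (root v) v \<noteq> {}"
    unfolding root_def by (rule someI)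
  then show ?thesis
    unfolding root_walk_def by (simp add: some_in_eq)
qed

lemma root_cong:
  assumes "W \<in> walks_between G x y"
  shows "root x = root y"
proof -
  have "walks_between G r x \<noteq> {} \<longleftrightarrow> walks_between G r y \<noteq> {}" for r
    using walks_between_concat[of _ G r x W y] walks_between_concat[of _ G r y "walk_inverse W" x]
      assms walks_between_inverse[OF assms] by blast
  then show ?thesis
    unfolding root_def by simp
qed

lemma rooted_closure:
  assumes W: "W \<in> walks_between G x y"
  shows "root_walk x \<cdot> W \<cdot> walk_inverse (root_walk y) \<in> walks_between G (root x) (root x)"
  using root_walk[OF walks_between_verts(1)[OF W]] W
    walks_between_inverse[OF root_walk[OF walks_between_verts(2)[OF W]]]
  by (simp add: root_cong[OF W]) (blast intro: walks_between_concat)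

lemma rooted_sign_eq:
  "W \<in> walks_between G x y \<Longrightarrow>
    rooted_sign W = closed_sign (root_walk x \<cdot> W \<cdot> walk_inverse (root_walk y))"
  by (simp add: rooted_sign_def walks_between_def)

text \<open>The closed walk that completes \<open>A B\<close> becomes the concatenation of those that complete
  \<open>A\<close> and \<open>B\<close> when a detour from \<open>y\<close> to the root is inserted between \<open>A\<close> and \<open>B\<close>.\<close>

lemma rooted_sign_concat:
  assumes A: "A \<in> walks_between G x y" and B: "B \<in> walks_between G y z"
  shows "rooted_sign (A \<cdot> B) = rooted_sign A * rooted_sign B"
proof -
  let ?P = root_walk and ?inv = walk_inverse
  have x: "?P x \<in> walks_between G (root y) x"
    using root_walk[OF walks_between_verts(1)[OF A]] by (simp add: root_cong[OF A])
  have y: "?inv (?P y) \<in> walks_between G y (root y)"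
    using root_walk[OF walks_between_verts(2)[OF A]] by (rule walks_between_inverse)
  have z: "?inv (?P z) \<in> walks_between G z (root y)"
    using walks_between_inverse[OF root_walk[OF walks_between_verts(2)[OF B]]]
    by (simp add: root_cong[OF B])
  have "rooted_sign (A \<cdot> B) = closed_sign (?P x \<cdot> (A \<cdot> B) \<cdot> ?inv (?P z))"
    by (rule rooted_sign_eq[OF walks_between_concat[OF A B]])
  also have "\<dots> = closed_sign ((?P x \<cdot> A) \<cdot> (B \<cdot> ?inv (?P z)))"
    by (simp add: walk_concat_assoc)
  also have "\<dots> = closed_sign ((?P x \<cdot> A) \<cdot> ?inv (?P y) \<cdot> ?inv (?inv (?P y)) \<cdot> (B \<cdot> ?inv (?P z)))"
    by (rule closed_sign_detour[OF walks_between_concat[OF x A] walks_between_concat[OF B z] y,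
          symmetric])
  also have "\<dots> = closed_sign ((?P x \<cdot> A \<cdot> ?inv (?P y)) \<cdot> (?P y \<cdot> B \<cdot> ?inv (?P z)))"
    by (simp add: walk_concat_assoc)
  also have "\<dots> = closed_sign (?P x \<cdot> A \<cdot> ?inv (?P y)) * closed_sign (?P y \<cdot> B \<cdot> ?inv (?P z))"
    using closed_sign_concat[OF rooted_closure[OF A]] rooted_closure[OF B]
    by (simp add: root_cong[OF A])
  finally show ?thesis
    by (simp add: rooted_sign_eq[OF A] rooted_sign_eq[OF B])
qed

lemma rooted_sign_inverse:
  assumes W: "W \<in> walks_between G x y"
  shows "rooted_sign (walk_inverse W) = rooted_sign W"
proof -
  let ?C = "root_walk x \<cdot> W \<cdot> walk_inverse (root_walk y)"
  have ends: "walk_end (root_walk x) = x" "walk_start W = x" "walk_end W = y"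
      "walk_end (root_walk y) = y"
    using W root_walk[OF walks_between_verts(1)[OF W]] root_walk[OF walks_between_verts(2)[OF W]]
    by (auto simp: walks_between_def)
  have "walk_inverse ?C = root_walk y \<cdot> walk_inverse W \<cdot> walk_inverse (root_walk x)"
    by (simp add: walk_inverse_concat walk_start_concat ends walk_concat_assoc)
  then show ?thesis
    using closed_sign_inverse[OF rooted_closure[OF W]]
    by (simp add: rooted_sign_eq[OF W] rooted_sign_eq[OF walks_between_inverse[OF W]])
qed

text \<open>Rotating \<open>P\<^sub>x W P\<^sub>x\<^sup>-\<^sup>1\<close> turns the two root walks into a detour.\<close>

lemma rooted_sign_closed:
  assumes W: "W \<in> walks_between G x x"
  shows "rooted_sign W = closed_sign W"
proof -
  let ?P = "root_walk x"
  have P: "?P \<in> walks_between G (root x) x"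
    using root_walk[OF walks_between_verts(1)[OF W]] .
  have P': "walk_inverse ?P \<in> walks_between G x (root x)"
    using P by (rule walks_between_inverse)
  have "rooted_sign W = closed_sign (?P \<cdot> W \<cdot> walk_inverse ?P)"
    by (rule rooted_sign_eq[OF W])
  also have "\<dots> = closed_sign ((W \<cdot> walk_inverse ?P) \<cdot> ?P)"
    using closed_sign_rotate[OF P walks_between_concat[OF W P']] .
  also have "\<dots> = closed_sign (W \<cdot> (walk_inverse ?P \<cdot> walk_inverse (walk_inverse ?P)))"
    by (simp add: walk_concat_assoc)
  also have "\<dots> = closed_sign W"
    using closed_sign_concat[OF W walks_between_concat[OF P' P]] closed_sign_backtrack[OF P']
    by simp
  finally show ?thesis .
qed

lemma rooted_sign_edge:
  assumes uv: "Step u e (Trivial v) \<in> walks_between G u v"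
  shows "rooted_sign (Step u e (Trivial v)) = edge_sign e"
proof -
  have same: "rooted_sign (Step a e (Trivial b)) = rooted_sign (Step u e (Trivial v))"
    if ab: "Step a e (Trivial b) \<in> walks_between G a b" for a b
  proof -
    have "{#a, b#} = {#u, v#}"
      using ab uv by (simp add: walks_between_def)
    then have "set_mset {#a, b#} = set_mset {#u, v#}"
      by (rule arg_cong)
    then have "(a = u \<and> b = v) \<or> (a = v \<and> b = u)"
      by (simp add: doubleton_eq_iff)
    then show ?thesis
      using rooted_sign_inverse[OF uv] by auto
  qed
  have "(\<exists>a b. Step a e (Trivial b) \<in> walks_between G a b \<and> rooted_sign (Step a e (Trivial b)) = - 1)
      \<longleftrightarrow> rooted_sign (Step u e (Trivial v)) = - 1"
    using same uv by metis
  moreover have "rooted_sign (Step u e (Trivial v)) = 1 \<or> rooted_sign (Step u e (Trivial v)) = - 1"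
    unfolding rooted_sign_def by (rule closed_sign_cases)
  ultimately show ?thesis
    unfolding edge_sign_def by presburger
qed

lemma rooted_sign_eq_walk_sign:
  "is_walk G W \<Longrightarrow> rooted_sign W = walk_sign edge_sign W"
proof (induction W)
  case (Trivial v)
  then have triv: "Trivial v \<in> walks_between G v v"
    by (simp add: walks_between_def)
  show ?case
    using rooted_sign_closed[OF triv] closed_sign_backtrack[OF triv] by simp
next
  case (Step v e W)
  let ?E = "Step v e (Trivial (walk_start W))"
  have E: "?E \<in> walks_between G v (walk_start W)"
    using Step.prems by (simp add: walks_between_def walk_start_in_verts)
  have W: "W \<in> walks_between G (walk_start W) (walk_end W)"
    using Step.prems by (simp add: walks_between_def)
  have "rooted_sign (Step v e W) = rooted_sign (?E \<cdot> W)"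
    by simp
  also have "\<dots> = edge_sign e * walk_sign edge_sign W"
    using Step by (simp only: rooted_sign_concat[OF E W] rooted_sign_edge[OF E]) simp
  finally show ?case
    by simp
qed

lemma signature_edge_sign: "signature G edge_sign"
  by (simp add: signature_def edge_sign_def)

lemma negative_closed_walks_edge_sign:
  "negative_closed_walks G edge_sign = \<W> \<inter> closed_walks G"
proof -
  have "walk_sign edge_sign W = closed_sign W" if "W \<in> closed_walks G" for W
    using that rooted_sign_eq_walk_sign[of W] rooted_sign_closed[of W "walk_start W"]
    by (simp add: closed_walks_def walks_between_def)
  then show ?thesis
    by (auto simp: negative_closed_walks_def closed_sign_def split: if_splits)
qed

end

section \<open>Characterisation of the sets of negative closed walks\<close>

theorem theorem10:
  fixes G :: "('v, 'e) multigraph" and \<W> :: "('v, 'e) walk set"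
  assumes "graph G" and "\<W> \<subseteq> closed_walks G"
  shows "(\<exists>\<sigma>. signature G \<sigma> \<and> \<W> = negative_closed_walks G \<sigma>) \<longleftrightarrow>
         exclusive_3_walk_property G \<W>"
proof
  assume "\<exists>\<sigma>. signature G \<sigma> \<and> \<W> = negative_closed_walks G \<sigma>"
  then show "exclusive_3_walk_property G \<W>"
    using negative_closed_walks_exclusive by blast
next
  assume "exclusive_3_walk_property G \<W>"
  then interpret exclusive_3_walk_set G \<W>
    by unfold_locales
  have "\<W> = negative_closed_walks G edge_sign"
    using assms(2) negative_closed_walks_edge_sign by blast
  then show "\<exists>\<sigma>. signature G \<sigma> \<and> \<W> = negative_closed_walks G \<sigma>"
    using signature_edge_sign by blast
qed

end
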